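(* Let $p,q\in(0,1)$, let $p_{\alpha^{s}_0},p_{\alpha^{s}_1}\in[0,1]$ be the sampling probabilities and $p_{s_0},p_{s_1}\in[0,1]$ the success probabilities of the state-aware randomized stationary policy, write $a_i=p_{\alpha^{s}_i}p_{s_i}$ for $i=0,1$, and assume $\Phi=p\,a_1(1-a_0)+a_0\big(q+(1-q)a_1\big)>0$. Let $(X(t),\hat X(t))$ be in its stationary regime with stationary distribution $\pi_{i,j}$, and let $C_E(t)$ be the consecutive error. Then: 1. $\Pr[C_E(t)=0]=\pi_{0,0}+\pi_{1,1}$, and for every integer $i\ge 1$, $$\Pr[C_E(t)=i]=p(1-q)^{i-1}(1-a_1)^{i}\,\pi_{0,0}+q(1-p)^{i-1}(1-a_0)^{i}\,\pi_{1,1}.$$ 2. The transition probabilities $P_{i,i+1}=\Pr[C_E(t+1)=i+1\mid C_E(t)=i]$ (for those $i$ with $\Pr[C_E(t)=i]>0$) are $$P_{0,1}=\frac{p(1-a_1)\pi_{0,0}+q(1-a_0)\pi_{1,1}}{\pi_{0,0}+\pi_{1,1}},$$ $$P_{i,i+1}=\frac{p(1-q)^{i}(1-a_1)^{i+1}\pi_{0,0}+q(1-p)^{i}(1-a_0)^{i+1}\pi_{1,1}}{p(1-q)^{i-1}(1-a_1)^{i}\pi_{0,0}+q(1-p)^{i-1}(1-a_0)^{i}\pi_{1,1}},\quad i\ge1.$$ 3. The average consecutive error $\bar C_E=\sum_{x\ge1}x\Pr[C_E(t)=x]$ equals $$\bar C_E=\frac{p(1-a_1)\pi_{0,0}}{\big(q+(1-q)a_1\big)^2}+\frac{q(1-a_0)\pi_{1,1}}{\big(p+(1-p)a_0\big)^2}.$$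 4. For every finite integer $n\ge 0$, the consecutive error violation probability is $$\Pr[C_E(t)>n]=\frac{pq\,a_0\big[(1-q)(1-a_1)\big]^{n+1}}{(1-q)(p+q)\Phi}+\frac{pq\,a_1\big[(1-p)(1-a_0)\big]^{n+1}}{(1-p)(p+q)\Phi}.$$
   Context: The source $X(t)$ is a discrete-time Markov chain on $\{0,1\}$ with $\Pr[X(t+1)=1\mid X(t)=0]=p$ and $\Pr[X(t+1)=0\mid X(t)=1]=q$ (self-transition probabilities $1-p$ and $1-q$). State-aware randomized stationary policy: in each slot $t+1$, if $X(t+1)=i$, then, independently of everything else, the source is sampled and the sample transmitted (in the same slot) with probability $p_{\alpha^{s}_i}$, and otherwise nothing is sent; a transmission made when the source is in state $i$ succeeds with probability $p_{s_i}$, independently of everything else. The reconstructed source satisfies $\hat X(t+1)=X(t+1)$ if a transmission succeeds in slot $t+1$, and $\hat X(t+1)=\hat X(t)$ otherwise. The stationary distribution $\pi_{i,j}$ (probability of $X(t)=i,\hat X(t)=j$) of the chain $(X(t),\hat X(t))$ is, with $a_i=p_{\alpha^{s}_i}p_{s_i}$ and $\Phi$ as in the claim, $\pi_{0,0}=\frac{q a_0[q+(1-q)a_1]}{(p+q)\Phi}$, $\pi_{0,1}=\frac{pq a_1(1-a_0)}{(p+q)\Phi}$, $\pi_{1,0}=\frac{pq a_0(1-a_1)}{(p+q)\Phi}$, $\pi_{1,1}=\frac{p a_1[p+(1-p)a_0]}{(p+q)\Phi}$. The system is synced at time $t$ if $X(t)=\hat X(t)$ and erroneous if $X(t)\ne\hat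 X(t)$. The consecutive error $C_E(t)$ is the number of consecutive time slots, up to and including $t$, during which the system has been erroneous: $C_E(t)=0$ if the system is synced at $t$, and for $i\ge1$, $C_E(t)=i$ means the system was synced at $t-i$ and erroneous at all slots $t-i+1,\dots,t$. The stationary regime may be taken as the two-sided stationary process. *)

theory Defs
  imports "HOL-Probability.Probability" "HOL-Library.Z2"
begin

subsection \<open>Two-sided Markov chains in their stationary regime\<close>

definition stationary_distribution :: "('s \<Rightarrow> 's pmf) \<Rightarrow> 's pmf \<Rightarrow> bool" where
  "stationary_distribution K \<pi> \<longleftrightarrow> bind_pmf \<pi> K = \<pi>"

text \<open>
  The history of the process up to time \<^term>\<open>t::int\<close> is read backwards: \<^term>\<open>h k\<close> is the state at
  \<^term>\<open>t - int k\<close>, so \<^term>\<open>h 0\<close> is the present state.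
\<close>

definition markov_process :: "'w measure \<Rightarrow> ('s \<Rightarrow> 's pmf) \<Rightarrow> (int \<Rightarrow> 'w \<Rightarrow> 's) \<Rightarrow> bool" where
  "markov_process M K Z \<longleftrightarrow>
     (\<forall>t. Z t \<in> measurable M (count_space UNIV)) \<and>
     (\<forall>t n (h :: nat \<Rightarrow> 's) z.
        \<P>(\<omega> in M. \<forall>k\<le>n. Z (t - int k) \<omega> = h k) > 0 \<longrightarrow>
        \<P>(\<omega> in M. Z (t + 1) \<omega> = z \<bar> (\<forall>k\<le>n. Z (t - int k) \<omega> = h k)) = pmf (K (h 0)) z)"

definition stationary_markov_process ::
  "'w measure \<Rightarrow> ('s \<Rightarrow> 's pmf) \<Rightarrow> 's pmf \<Rightarrow> (int \<Rightarrow> 'w \<Rightarrow> 's) \<Rightarrow> bool" where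
  "stationary_markov_process M K \<pi> Z \<longleftrightarrow>
     stationary_distribution K \<pi> \<and> markov_process M K Z \<and>
     (\<forall>t. distr M (count_space UNIV) (Z t) = measure_pmf \<pi>)"


subsection \<open>Source and state-aware randomized stationary policy\<close>

definition source_step :: "real \<Rightarrow> real \<Rightarrow> bit \<Rightarrow> bit pmf" where
  "source_step p q x =
     map_pmf of_bool (if x = 0 then bernoulli_pmf p else bernoulli_pmf (1 - q))"

text \<open>
  One slot of the pair (source, reconstructed source): the source moves first, and both the
  sampling and the success probability are those of the new source state.
\<close>

definition policy_step ::
  "real \<Rightarrow> real \<Rightarrow> (bit \<Rightarrow> real) \<Rightarrow> (bit \<Rightarrow> real) \<Rightarrow> bit \<times> bit \<Rightarrow> (bit \<times> bit) pmf" where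
  "policy_step p q p\<^sub>\<alpha> p\<^sub>s z =
     do {
       x' \<leftarrow> source_step p q (fst z);
       transmit \<leftarrow> bernoulli_pmf (p\<^sub>\<alpha> x');
       success \<leftarrow> (if transmit then bernoulli_pmf (p\<^sub>s x') else return_pmf False);
       return_pmf (x', if success then x' else snd z)
     }"


subsection \<open>Consecutive error\<close>

text \<open>
  The value is \<open>\<infinity>\<close> if the system has been erroneous in every slot up to \<^term>\<open>t::int\<close>.
\<close>

definition consecutive_error :: "(int \<Rightarrow> 'w \<Rightarrow> 's) \<Rightarrow> (int \<Rightarrow> 'w \<Rightarrow> 's) \<Rightarrow> int \<Rightarrow> 'w \<Rightarrow> enat" where
  "consecutive_error X Xhat t \<omega> =
     (if \<exists>k::nat. X (t - int k) \<omega> = Xhat (t - int k) \<omega>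
      then enat (LEAST k. X (t - int k) \<omega> = Xhat (t - int k) \<omega>)
      else \<infinity>)"


subsection \<open>The stationary distribution in closed form\<close>

lemma bit_pair_UNIV: "(UNIV :: (bit \<times> bit) set) = {(0,0), (0,1), (1,0), (1,1)}"
proof -
  have "(UNIV :: bit set) = {0, 1}" by (auto intro: bit.exhaust)
  then have "(UNIV :: (bit \<times> bit) set) = {0, 1} \<times> {0, 1}"
    by (metis UNIV_Times_UNIV)
  then show ?thesis by auto
qed

lemma pmf_policy_step:
  assumes "p \<in> {0..1}" "q \<in> {0..1}" "\<And>i. pa i \<in> {0..1}" "\<And>i. ps i \<in> {0..1}"
  shows "pmf (policy_step p q pa ps (x, y)) (x', y') =
    (if x = 0 then (if x' = 1 then p else 1 - p) else (if x' = 1 then 1 - q else q)) *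
    (pa x' * ps x' * of_bool (y' = x') + (1 - pa x' * ps x') * of_bool (y' = y))"
proof -
  have [simp]: "0 \<le> pa i" "pa i \<le> 1" "0 \<le> ps i" "ps i \<le> 1" for i using assms by auto
  show ?thesis
    using assms
    apply (cases x; cases x'; cases y; cases y')
    apply (simp_all add: policy_step_def source_step_def pmf_bind integral_bernoulli_pmf bind_map_pmf pmf_return indicator_def algebra_simps)
    done
qed

lemma stationary_distribution_policy_step:
  fixes pa ps :: "bit \<Rightarrow> real" and \<pi> :: "(bit \<times> bit) pmf"
  assumes p: "p \<in> {0<..<1}" and q: "q \<in> {0<..<1}"
    and pa: "\<And>i. pa i \<in> {0..1}" and ps: "\<And>i. ps i \<in> {0..1}"
    and a: "\<And>i. a i = pa i * ps i"
    and \<Phi>: "\<Phi> = p * a 1 * (1 - a 0) + a 0 * (q + (1 - q) * a 1)"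
    and \<Phi>_pos: "\<Phi> > 0"
  shows "stationary_distribution (policy_step p q pa ps) \<pi> \<longleftrightarrow>
     pmf \<pi> (0,0) = q * a 0 * (q + (1 - q) * a 1) / ((p + q) * \<Phi>) \<and>
     pmf \<pi> (0,1) = p * q * a 1 * (1 - a 0) / ((p + q) * \<Phi>) \<and>
     pmf \<pi> (1,0) = p * q * a 0 * (1 - a 1) / ((p + q) * \<Phi>) \<and>
     pmf \<pi> (1,1) = p * a 1 * (p + (1 - p) * a 0) / ((p + q) * \<Phi>)" (is "_ \<longleftrightarrow> ?F")
proof -
  define w x y z where "w = pmf \<pi> (0,0)" and "x = pmf \<pi> (0,1)" and "y = pmf \<pi> (1,0)" and "z = pmf \<pi> (1,1)"
  note wd = w_def x_def y_def z_def
  have fin: "finite (UNIV :: (bit \<times> bit) set)" by (simp add: bit_pair_UNIV)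
  have tot: "w + x + y + z = 1"
    using sum_pmf_eq_1[OF fin subset_UNIV, of \<pi>] by (simp add: bit_pair_UNIV wd algebra_simps)
  have bnd: "0 \<le> a i" "a i \<le> 1" for i
    using pa[of i] ps[of i] by (auto simp: a mult_le_one)
  have b: "pmf (bind_pmf \<pi> (policy_step p q pa ps)) s =
     (\<Sum>r\<in>UNIV. pmf \<pi> r * pmf (policy_step p q pa ps r) s)" for s
    unfolding pmf_bind by (subst integral_measure_pmf_real[of UNIV]) (auto simp: fin mult.commute)
  have k: "pmf (policy_step p q pa ps (x, y)) (x', y') =
    (if x = 0 then (if x' = 1 then p else 1 - p) else (if x' = 1 then 1 - q else q)) *
    (a x' * of_bool (y' = x') + (1 - a x') * of_bool (y' = y))" for x y x' y'
    using pmf_policy_step[of p q pa ps x y x' y'] p q pa ps by (auto simp: a)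
  have "stationary_distribution (policy_step p q pa ps) \<pi> \<longleftrightarrow>
     (\<forall>s\<in>UNIV. pmf (bind_pmf \<pi> (policy_step p q pa ps)) s = pmf \<pi> s)"
    by (auto simp: stationary_distribution_def pmf_eq_iff)
  also have "\<dots> \<longleftrightarrow>
     (1 - p) * (w + x * a 0) + q * (y + z * a 0) = w \<and>
     (1 - p) * (1 - a 0) * x + q * (1 - a 0) * z = x \<and>
     p * (1 - a 1) * w + (1 - q) * (1 - a 1) * y = y \<and>
     p * (w * a 1 + x) + (1 - q) * (y * a 1 + z) = z"
    unfolding b by (simp add: bit_pair_UNIV k wd algebra_simps)
  also have "\<dots> \<longleftrightarrow> ?F"
    unfolding wd[symmetric]
  proof
    assume E: "(1 - p) * (w + x * a 0) + q * (y + z * a 0) = w \<and>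
     (1 - p) * (1 - a 0) * x + q * (1 - a 0) * z = x \<and>
     p * (1 - a 1) * w + (1 - q) * (1 - a 1) * y = y \<and>
     p * (w * a 1 + x) + (1 - q) * (y * a 1 + z) = z"
    define u v where "u = p + (1 - p) * a 0" and "v = q + (1 - q) * a 1"
    have uv: "u > 0" "v > 0" using p q bnd[of 0] bnd[of 1] by (auto simp: u_def v_def intro!: add_pos_nonneg)
    have e1: "x * u = q * (1 - a 0) * z" using E by (simp add: u_def algebra_simps)
    have e2: "y * v = p * (1 - a 1) * w" using E by (simp add: v_def algebra_simps)
    have e3: "p * (w + x) = q * (y + z)"
    proof -
      have "(1 - p) * (w + x * a 0) + q * (y + z * a 0) + ((1 - p) * (1 - a 0) * x + q * (1 - a 0) * z) = w + x"
        using E by simp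
      then show ?thesis by (simp add: algebra_simps)
    qed
    have e4: "(p + q) * (w + x) = q" using e3 tot by (simp add: algebra_simps) (algebra)
    have e5: "(p + q) * (y + z) = p" using e3 tot by (simp add: algebra_simps) (algebra)
    have W: "w * ((p + q) * \<Phi>) = q * a 0 * v"
      using e1 e2 e4 e5 \<Phi> unfolding u_def v_def by algebra
    have Z: "z * ((p + q) * \<Phi>) = p * a 1 * u"
      using e1 e2 e4 e5 \<Phi> unfolding u_def v_def by algebra
    have "x * ((p + q) * \<Phi>) * u = p * q * a 1 * (1 - a 0) * u" using e1 Z by algebra
    then have X: "x * ((p + q) * \<Phi>) = p * q * a 1 * (1 - a 0)" using uv by simp
    have "y * ((p + q) * \<Phi>) * v = p * q * a 0 * (1 - a 1) * v" using e2 W by algebra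
    then have Y: "y * ((p + q) * \<Phi>) = p * q * a 0 * (1 - a 1)" using uv by simp
    have "(p + q) * \<Phi> \<noteq> 0" using p q \<Phi>_pos by auto
    with W X Y Z show "w = q * a 0 * (q + (1 - q) * a 1) / ((p + q) * \<Phi>) \<and>
      x = p * q * a 1 * (1 - a 0) / ((p + q) * \<Phi>) \<and>
      y = p * q * a 0 * (1 - a 1) / ((p + q) * \<Phi>) \<and>
      z = p * a 1 * (p + (1 - p) * a 0) / ((p + q) * \<Phi>)"
      by (simp add: nonzero_eq_divide_eq u_def v_def)
  next
    assume F: "w = q * a 0 * (q + (1 - q) * a 1) / ((p + q) * \<Phi>) \<and>
      x = p * q * a 1 * (1 - a 0) / ((p + q) * \<Phi>) \<and>
      y = p * q * a 0 * (1 - a 1) / ((p + q) * \<Phi>) \<and>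
      z = p * a 1 * (p + (1 - p) * a 0) / ((p + q) * \<Phi>)"
    define D where "D = 1 / ((p + q) * \<Phi>)"
    have F': "w = q * a 0 * (q + (1 - q) * a 1) * D" "x = p * q * a 1 * (1 - a 0) * D"
      "y = p * q * a 0 * (1 - a 1) * D" "z = p * a 1 * (p + (1 - p) * a 0) * D"
      using F by (simp_all add: D_def)
    show "(1 - p) * (w + x * a 0) + q * (y + z * a 0) = w \<and>
     (1 - p) * (1 - a 0) * x + q * (1 - a 0) * z = x \<and>
     p * (1 - a 1) * w + (1 - q) * (1 - a 1) * y = y \<and>
     p * (w * a 1 + x) + (1 - q) * (y * a 1 + z) = z"
      unfolding F' by (intro conjI; algebra)
  qed
  finally show ?thesis .
qed

end

(*
  An error can only end, never change its type: from (1,0) or (0,1) the pair either stays put or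
  becomes synced.  Hence an error run of length n + 1 is almost surely a constant path, and
  P(C_E > n) = pi(1,0) r^n + pi(0,1) s^n with r, s the holding probabilities of the two error
  states.  The point probabilities are the differences of these tails, and the balance
  equations of the two error states turn pi(1,0), pi(0,1) into pi(0,0), pi(1,1).
*)
theory Submission
  imports Defs
begin

text \<open>Strict tails are the convenient events: they involve finitely many slots only, and the
  value \<open>\<infinity>\<close> satisfies every one of them, matching a path that is erroneous at
  all earlier slots.\<close>

lemma less_consecutive_error_iff:
  "enat n < consecutive_error X Xhat t \<omega> \<longleftrightarrow> (\<forall>k\<le>n. X (t - int k) \<omega> \<noteq> Xhat (t - int k) \<omega>)"
proof (cases "\<exists>k::nat. X (t - int k) \<omega> = Xhat (t - int k) \<omega>")
  case True
  define L where "L = (LEAST k::nat. X (t - int k) \<omega> = Xhat (t - int k) \<omega>)"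
  have "X (t - int L) \<omega> = Xhat (t - int L) \<omega>"
    unfolding L_def using True by (rule LeastI_ex)
  moreover have "X (t - int k) \<omega> \<noteq> Xhat (t - int k) \<omega>" if "k < L" for k
    using that unfolding L_def by (rule not_less_Least)
  ultimately have "n < L \<longleftrightarrow> (\<forall>k\<le>n. X (t - int k) \<omega> \<noteq> Xhat (t - int k) \<omega>)"
    by (metis le_less_trans not_le)
  then show ?thesis
    using True by (simp add: consecutive_error_def L_def)
qed (simp add: consecutive_error_def)

text \<open>Dropping the newest slot of an error run shortens it by one. This pathwise inclusion of
  events later turns the conditional probabilities into plain quotients.\<close>

lemma consecutive_error_shift:
  assumes "consecutive_error X Xhat (t + 1) \<omega> = enat (Suc i)"
  shows "consecutive_error X Xhat t \<omega> = enat i"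
proof -
  \<comment> \<open>Slot \<open>t + 1\<close> is split off and the others are counted back from
    \<open>t\<close>; this shift by one turns \<open>k \<le> m\<close> into
    \<open>k < m\<close>.\<close>
  have tail: "enat m < consecutive_error X Xhat (t + 1) \<omega> \<longleftrightarrow>
      X (t + 1) \<omega> \<noteq> Xhat (t + 1) \<omega> \<and> (\<forall>k<m. X (t - int k) \<omega> \<noteq> Xhat (t - int k) \<omega>)" for m
  proof -
    have *: "(\<forall>k\<le>m. P k) \<longleftrightarrow> P 0 \<and> (\<forall>k<m. P (Suc k))" for P :: "nat \<Rightarrow> bool"
      by (metis Suc_leI less_Suc_eq_le Suc_le_eq not0_implies_Suc zero_le)
    show ?thesis
      unfolding less_consecutive_error_iff by (subst *) (simp add: algebra_simps)
  qed
  \<comment> \<open>The tail at \<open>i\<close> holds and gives the errors; the tail at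
    \<open>Suc i\<close> fails, and the only slot left to break it is
    \<open>t - int i\<close>.\<close>
  have "X (t - int i) \<omega> = Xhat (t - int i) \<omega>" and before: "\<And>k. k < i \<Longrightarrow> X (t - int k) \<omega> \<noteq> Xhat (t - int k) \<omega>"
    using assms tail[of i] tail[of "Suc i"] by (auto simp: less_Suc_eq)
  then have "\<not> enat i < consecutive_error X Xhat t \<omega>"
    by (auto simp: less_consecutive_error_iff)
  moreover have "\<not> consecutive_error X Xhat t \<omega> < enat i"
  proof
    assume "consecutive_error X Xhat t \<omega> < enat i"
    then obtain m where m: "consecutive_error X Xhat t \<omega> = enat m" "m < i"
      by (cases "consecutive_error X Xhat t \<omega>") auto
    then have "\<not> enat m < consecutive_error X Xhat t \<omega>" by simp
    then show False
      using before m(2) by (auto simp: less_consecutive_error_iff)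
  qed
  ultimately show ?thesis by (meson antisym_conv3)
qed

text \<open>Product form of the Markov property. It covers null histories too, where both sides
  vanish.\<close>

lemma (in prob_space) markov_process_step:
  assumes "markov_process M K Z"
  shows "\<P>(\<omega> in M. Z (t + 1) \<omega> = z \<and> (\<forall>k\<le>n. Z (t - int k) \<omega> = h k)) =
    pmf (K (h 0)) z * \<P>(\<omega> in M. \<forall>k\<le>n. Z (t - int k) \<omega> = h k)"
proof -
  have [measurable]: "Z s \<in> measurable M (count_space UNIV)" for s
    using assms by (simp add: markov_process_def)
  let ?B = "\<P>(\<omega> in M. \<forall>k\<le>n. Z (t - int k) \<omega> = h k)"
  show ?thesis
  proof (cases "?B > 0")
    case True
    then have "\<P>(\<omega> in M. Z (t + 1) \<omega> = z \<bar> (\<forall>k\<le>n. Z (t - int k) \<omega> = h k)) = pmf (K (h 0)) z"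
      using assms by (simp add: markov_process_def)
    then show ?thesis
      using True by (simp add: cond_prob_def field_simps)
  next
    case False
    then have "?B = 0" by (simp add: zero_less_measure_iff)
    moreover have "\<P>(\<omega> in M. Z (t + 1) \<omega> = z \<and> (\<forall>k\<le>n. Z (t - int k) \<omega> = h k)) \<le> ?B"
      by (rule finite_measure_mono) auto
    ultimately show ?thesis by (simp add: measure_le_0_iff)
  qed
qed

text \<open>The oldest slot contributes the stationary mass and each of the \<open>n\<close> steps a
  holding probability. The induction peels off the newest slot, so \<open>t\<close> must
  vary.\<close>

lemma (in prob_space) stationary_markov_process_constant_path:
  assumes "stationary_markov_process M K \<pi> Z"
  shows "\<P>(\<omega> in M. \<forall>k\<le>n. Z (t - int k) \<omega> = z) = pmf \<pi> z * pmf (K z) z ^ n"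
proof (induction n arbitrary: t)
  case 0
  have [measurable]: "Z t \<in> measurable M (count_space UNIV)"
    and distr: "distr M (count_space UNIV) (Z t) = measure_pmf \<pi>"
    using assms by (auto simp: stationary_markov_process_def markov_process_def)
  have "pmf \<pi> z = measure (distr M (count_space UNIV) (Z t)) {z}"
    by (simp add: distr pmf.rep_eq)
  also have "\<dots> = \<P>(\<omega> in M. Z t \<omega> = z)"
    by (subst measure_distr) (auto intro!: arg_cong[where f = "measure M"])
  finally show ?case by simp
next
  case (Suc n)
  have *: "(\<forall>k\<le>Suc n. P k) \<longleftrightarrow> P 0 \<and> (\<forall>k\<le>n. P (Suc k))" for P :: "nat \<Rightarrow> bool"
    by (metis Suc_le_mono not0_implies_Suc zero_le)
  have "\<P>(\<omega> in M. \<forall>k\<le>Suc n. Z (t - int k) \<omega> = z) =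
      \<P>(\<omega> in M. Z ((t - 1) + 1) \<omega> = z \<and> (\<forall>k\<le>n. Z ((t - 1) - int k) \<omega> = z))"
    by (subst *) (simp add: algebra_simps)
  also have "\<dots> = pmf (K z) z * \<P>(\<omega> in M. \<forall>k\<le>n. Z ((t - 1) - int k) \<omega> = z)"
    using assms markov_process_step[of K Z "t - 1" z n "\<lambda>_. z"]
    by (simp add: stationary_markov_process_def)
  finally show ?case by (simp add: Suc.IH)
qed

text \<open>Each single time gives a null event, and there are only countably many times, so one
  null set serves for all of them.\<close>

lemma (in prob_space) markov_process_AE_no_step:
  assumes "markov_process M K Z" and "pmf (K y) z = 0"
  shows "AE \<omega> in M. \<forall>t. \<not> (Z t \<omega> = y \<and> Z (t + 1) \<omega> = z)"
  unfolding AE_all_countable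
proof
  fix t
  have [measurable]: "Z s \<in> measurable M (count_space UNIV)" for s
    using assms by (simp add: markov_process_def)
  have "\<P>(\<omega> in M. Z (t + 1) \<omega> = z \<and> Z t \<omega> = y) = 0"
    using markov_process_step[OF assms(1), of t z 0 "\<lambda>_. y"] assms(2) by simp
  then have "\<P>(\<omega> in M. Z t \<omega> = y \<and> Z (t + 1) \<omega> = z) = 0"
    by (simp add: conj_commute)
  then show "AE \<omega> in M. \<not> (Z t \<omega> = y \<and> Z (t + 1) \<omega> = z)"
    by (subst (asm) prob_eq_0) auto
qed

theorem mainTheorem2:
  fixes M :: "'w measure"
    and p q :: real
    and p\<^sub>\<alpha> p\<^sub>s a :: "bit \<Rightarrow> real"
    and \<Phi> :: real
    and \<pi> :: "(bit \<times> bit) pmf"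
    and X Xhat :: "int \<Rightarrow> 'w \<Rightarrow> bit"
    and C\<^sub>E :: "int \<Rightarrow> 'w \<Rightarrow> enat"
    and t :: int
  assumes M: "prob_space M"
    and p: "p \<in> {0<..<1}" and q: "q \<in> {0<..<1}"
    and sampling: "\<And>i. p\<^sub>\<alpha> i \<in> {0..1}" and success: "\<And>i. p\<^sub>s i \<in> {0..1}"
    and a: "\<And>i. a i = p\<^sub>\<alpha> i * p\<^sub>s i"
    and \<Phi>: "\<Phi> = p * a 1 * (1 - a 0) + a 0 * (q + (1 - q) * a 1)"
    and \<Phi>_pos: "\<Phi> > 0"
    and stationary: "stationary_markov_process M (policy_step p q p\<^sub>\<alpha> p\<^sub>s) \<pi> (\<lambda>t \<omega>. (X t \<omega>, Xhat t \<omega>))"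
    and C\<^sub>E: "C\<^sub>E = consecutive_error X Xhat"
  shows
    "(\<P>(\<omega> in M. C\<^sub>E t \<omega> = 0) = pmf \<pi> (0,0) + pmf \<pi> (1,1) \<and>
     (\<forall>i::nat\<ge>1. \<P>(\<omega> in M. C\<^sub>E t \<omega> = enat i) =
         p * (1 - q) ^ (i - 1) * (1 - a 1) ^ i * pmf \<pi> (0,0)
         + q * (1 - p) ^ (i - 1) * (1 - a 0) ^ i * pmf \<pi> (1,1))) \<and>
     ((\<P>(\<omega> in M. C\<^sub>E t \<omega> = 0) > 0 \<longrightarrow>
       \<P>(\<omega> in M. C\<^sub>E (t + 1) \<omega> = 1 \<bar> C\<^sub>E t \<omega> = 0) =
         (p * (1 - a 1) * pmf \<pi> (0,0) + q * (1 - a 0) * pmf \<pi> (1,1))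
         / (pmf \<pi> (0,0) + pmf \<pi> (1,1))) \<and>
     (\<forall>i::nat\<ge>1. \<P>(\<omega> in M. C\<^sub>E t \<omega> = enat i) > 0 \<longrightarrow>
       \<P>(\<omega> in M. C\<^sub>E (t + 1) \<omega> = enat (i + 1) \<bar> C\<^sub>E t \<omega> = enat i) =
         (p * (1 - q) ^ i * (1 - a 1) ^ (i + 1) * pmf \<pi> (0,0)
          + q * (1 - p) ^ i * (1 - a 0) ^ (i + 1) * pmf \<pi> (1,1))
         / (p * (1 - q) ^ (i - 1) * (1 - a 1) ^ i * pmf \<pi> (0,0)
            + q * (1 - p) ^ (i - 1) * (1 - a 0) ^ i * pmf \<pi> (1,1)))) \<and>
     (((\<lambda>x::nat. real x * \<P>(\<omega> in M. C\<^sub>E t \<omega> = enat x)) has_sum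
        (p * (1 - a 1) * pmf \<pi> (0,0) / (q + (1 - q) * a 1)\<^sup>2
         + q * (1 - a 0) * pmf \<pi> (1,1) / (p + (1 - p) * a 0)\<^sup>2)) {1..}) \<and>
     (\<forall>n::nat. \<P>(\<omega> in M. C\<^sub>E t \<omega> > enat n) =
       p * q * a 0 * ((1 - q) * (1 - a 1)) ^ (n + 1) / ((1 - q) * (p + q) * \<Phi>)
       + p * q * a 1 * ((1 - p) * (1 - a 0)) ^ (n + 1) / ((1 - p) * (p + q) * \<Phi>))"
proof -
  interpret prob_space M by (fact M)
  let ?K = "policy_step p q p\<^sub>\<alpha> p\<^sub>s"
  let ?Z = "\<lambda>t \<omega>. (X t \<omega>, Xhat t \<omega>)"
  \<comment> \<open>\<open>r\<close> belongs to the error state \<open>(1,0)\<close> and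
    \<open>s\<close> to \<open>(0,1)\<close>: the source stays and no transmission succeeds.\<close>
  define r s where "r = (1 - q) * (1 - a 1)" and "s = (1 - p) * (1 - a 0)"
  have markov: "markov_process M ?K ?Z" and sd: "stationary_distribution ?K \<pi>"
    using stationary by (simp_all add: stationary_markov_process_def)
  have kernel: "pmf (?K (x, y)) (x', y') =
    (if x = 0 then (if x' = 1 then p else 1 - p) else (if x' = 1 then 1 - q else q)) *
    (a x' * of_bool (y' = x') + (1 - a x') * of_bool (y' = y))" for x y x' y'
    using pmf_policy_step[of p q p\<^sub>\<alpha> p\<^sub>s x y x' y'] p q sampling success by (auto simp: a)
  have a_bounds: "0 \<le> a i" "a i \<le> 1" for i
    using sampling[of i] success[of i] by (auto simp: a mult_le_one)
  have pi: "pmf \<pi> (0,0) = q * a 0 * (q + (1 - q) * a 1) / ((p + q) * \<Phi>)"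
      "pmf \<pi> (0,1) = p * q * a 1 * (1 - a 0) / ((p + q) * \<Phi>)"
      "pmf \<pi> (1,0) = p * q * a 0 * (1 - a 1) / ((p + q) * \<Phi>)"
      "pmf \<pi> (1,1) = p * a 1 * (p + (1 - p) * a 0) / ((p + q) * \<Phi>)"
    using sd stationary_distribution_policy_step[of p q p\<^sub>\<alpha> p\<^sub>s a \<Phi> \<pi>, OF p q sampling success a \<Phi> \<Phi>_pos]
    by blast+
  \<comment> \<open>The probabilities of leaving the error states are the bases of the squared
    denominators of the mean. Their positivity makes the geometric series converge.\<close>
  have escape: "1 - r = q + (1 - q) * a 1" "1 - s = p + (1 - p) * a 0"
    by (simp_all add: r_def s_def algebra_simps)
  have "0 < 1 - r" "0 < 1 - s"
    unfolding escape using p q a_bounds by (auto intro!: add_pos_nonneg)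
  moreover have "0 \<le> r" "0 \<le> s"
    using p q a_bounds by (auto simp: r_def s_def)
  ultimately have rs: "0 \<le> r" "r < 1" "0 \<le> s" "s < 1" by simp_all
  \<comment> \<open>Flow out of an error state equals flow in: \<open>(1,0)\<close> is entered from
    outside only from \<open>(0,0)\<close>, and \<open>(0,1)\<close> only from
    \<open>(1,1)\<close>.\<close>
  have balance: "pmf \<pi> (1,0) * (1 - r) = p * (1 - a 1) * pmf \<pi> (0,0)"
    "pmf \<pi> (0,1) * (1 - s) = q * (1 - a 0) * pmf \<pi> (1,1)"
    using pi by (simp_all add: escape algebra_simps)
  have total: "pmf \<pi> (0,0) + pmf \<pi> (0,1) + pmf \<pi> (1,0) + pmf \<pi> (1,1) = 1"
    using sum_pmf_eq_1[of UNIV \<pi>, OF _ subset_UNIV] by (simp add: bit_pair_UNIV)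
  have Z_meas [measurable]: "?Z t \<in> measurable M (count_space UNIV)" for t
    using markov by (simp add: markov_process_def)
  have tail_event: "{\<omega> \<in> space M. enat n < C\<^sub>E t \<omega>} =
      {\<omega> \<in> space M. \<forall>k\<le>n. X (t - int k) \<omega> \<noteq> Xhat (t - int k) \<omega>}" for n t
    by (simp add: C\<^sub>E less_consecutive_error_iff)
  \<comment> \<open>Measurability is given for the pair, so the error event is taken as the preimage
    of the off-diagonal.\<close>
  have sets_ne: "{\<omega> \<in> space M. X s \<omega> \<noteq> Xhat s \<omega>} \<in> events" for s
    using predE[OF pred_sets2[OF _ Z_meas, of "{z. fst z \<noteq> snd z}" s]] by simp
  have sets_state: "{\<omega> \<in> space M. ?Z s \<omega> = (x, y)} \<in> events" for s x y
    using predE[OF pred_sets2[OF _ Z_meas, of "{(x, y)}" s]] by simp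
  have tail_sets: "{\<omega> \<in> space M. enat n < C\<^sub>E t \<omega>} \<in> events" for n t
    unfolding tail_event by (intro sets.sets_Collect sets_ne)
  define A where "A x y n t = {\<omega> \<in> space M. \<forall>k\<le>n. ?Z (t - int k) \<omega> = (x, y)}" for x y n t
  have A_sets: "A x y n t \<in> events" for x y n t
    unfolding A_def by (intro sets.sets_Collect sets_state)
  have A_prob: "prob (A x y n t) = pmf \<pi> (x, y) * pmf (?K (x, y)) (x, y) ^ n" for x y n t
    unfolding A_def by (rule stationary_markov_process_constant_path[OF stationary])

  \<comment> \<open>Almost sure constancy of error runs\<close>
  have no_swap: "AE \<omega> in M. \<forall>t. \<not> (?Z t \<omega> = (1,0) \<and> ?Z (t + 1) \<omega> = (0,1))"
      "AE \<omega> in M. \<forall>t. \<not> (?Z t \<omega> = (0,1) \<and> ?Z (t + 1) \<omega> = (1,0))"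
    \<comment> \<open>After a swap the reconstruction would equal neither the new source state nor
      its own old value, so the kernel entry is 0.\<close>
    by (rule markov_process_AE_no_step[OF markov]; simp add: kernel)+
  have const_run: "?Z (t - int k) \<omega> = ?Z t \<omega>"
    if err: "\<forall>k\<le>n. X (t - int k) \<omega> \<noteq> Xhat (t - int k) \<omega>"
      and n1: "\<forall>t. \<not> (?Z t \<omega> = (1,0) \<and> ?Z (t + 1) \<omega> = (0,1))"
      and n2: "\<forall>t. \<not> (?Z t \<omega> = (0,1) \<and> ?Z (t + 1) \<omega> = (1,0))"
      and "k \<le> n" for k n t \<omega>
    using \<open>k \<le> n\<close>
  proof (induction k)
    case (Suc k)
    have bit_ne: "(b, c) = (1,0) \<or> (b, c) = (0,1)" if "b \<noteq> c" for b c :: bit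
      using that by (cases b; cases c) auto
    have "?Z (t - int (Suc k) + 1) \<omega> = ?Z (t - int k) \<omega>" by (simp add: algebra_simps)
    moreover have "?Z (t - int (Suc k)) \<omega> \<in> {(1,0), (0,1)}" "?Z (t - int k) \<omega> \<in> {(1,0), (0,1)}"
      using err Suc.prems bit_ne by (metis insertCI Suc_leD)+
    ultimately have "?Z (t - int (Suc k)) \<omega> = ?Z (t - int k) \<omega>"
      using n1 n2 by (metis insertE singletonD)
    with Suc show ?case by simp
  qed simp

  \<comment> \<open>Tail probabilities\<close>
  have tail: "\<P>(\<omega> in M. enat n < C\<^sub>E t \<omega>) = pmf \<pi> (1,0) * r ^ n + pmf \<pi> (0,1) * s ^ n" for n t
  proof -
    \<comment> \<open>The forward direction holds off the null set of swaps; the backward one holds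
      on every path.\<close>
    have "AE \<omega> in M. \<omega> \<in> {\<omega> \<in> space M. enat n < C\<^sub>E t \<omega>} \<longleftrightarrow> \<omega> \<in> A 1 0 n t \<union> A 0 1 n t"
      using no_swap AE_space
    proof eventually_elim
      case (elim \<omega>)
      show ?case
      proof
        assume "\<omega> \<in> {\<omega> \<in> space M. enat n < C\<^sub>E t \<omega>}"
        then have err: "\<forall>k\<le>n. X (t - int k) \<omega> \<noteq> Xhat (t - int k) \<omega>"
          by (simp add: tail_event)
        have const: "?Z (t - int k) \<omega> = ?Z t \<omega>" if "k \<le> n" for k
          using const_run[OF err elim(1,2)] that by simp
        have "X t \<omega> \<noteq> Xhat t \<omega>" using err[rule_format, of 0] by simp
        then have "?Z t \<omega> = (1,0) \<or> ?Z t \<omega> = (0,1)"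
          by (cases "X t \<omega>"; cases "Xhat t \<omega>") auto
        with const show "\<omega> \<in> A 1 0 n t \<union> A 0 1 n t"
          using elim by (auto simp: A_def)
      next
        assume "\<omega> \<in> A 1 0 n t \<union> A 0 1 n t"
        then show "\<omega> \<in> {\<omega> \<in> space M. enat n < C\<^sub>E t \<omega>}"
          unfolding tail_event by (auto simp: A_def)
      qed
    qed
    then have "\<P>(\<omega> in M. enat n < C\<^sub>E t \<omega>) = prob (A 1 0 n t \<union> A 0 1 n t)"
      by (intro finite_measure_eq_AE tail_sets sets.Un A_sets)
    also have "\<dots> = prob (A 1 0 n t) + prob (A 0 1 n t)"
      by (intro finite_measure_Union A_sets) (auto simp: A_def)
    finally show ?thesis
      by (simp add: A_prob kernel r_def s_def)
  qed

  \<comment> \<open>Point probabilities\<close>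
  have prob_0: "\<P>(\<omega> in M. C\<^sub>E t \<omega> = 0) = pmf \<pi> (0,0) + pmf \<pi> (1,1)" for t
  proof -
    have "\<P>(\<omega> in M. C\<^sub>E t \<omega> = 0) = prob (space M - {\<omega> \<in> space M. enat 0 < C\<^sub>E t \<omega>})"
      by (rule arg_cong[where f = prob]) (auto simp: zero_enat_def[symmetric])
    also have "\<dots> = 1 - \<P>(\<omega> in M. enat 0 < C\<^sub>E t \<omega>)"
      by (rule prob_compl[OF tail_sets])
    finally show ?thesis
      using total by (simp add: tail)
  qed

  have prob_Suc: "\<P>(\<omega> in M. C\<^sub>E t \<omega> = enat (Suc j)) =
      p * (1 - a 1) * pmf \<pi> (0,0) * r ^ j + q * (1 - a 0) * pmf \<pi> (1,1) * s ^ j" for j t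
  proof -
    have "\<P>(\<omega> in M. C\<^sub>E t \<omega> = enat (Suc j)) =
        prob ({\<omega> \<in> space M. enat j < C\<^sub>E t \<omega>} - {\<omega> \<in> space M. enat (Suc j) < C\<^sub>E t \<omega>})"
    proof -
      have "c = enat (Suc j) \<longleftrightarrow> enat j < c \<and> \<not> enat (Suc j) < c" for c
        by (cases c) auto
      then show ?thesis by (intro arg_cong[where f = prob]) auto
    qed
    also have "\<dots> = \<P>(\<omega> in M. enat j < C\<^sub>E t \<omega>) - \<P>(\<omega> in M. enat (Suc j) < C\<^sub>E t \<omega>)"
      by (intro finite_measure_Diff tail_sets) (auto intro: less_trans[of "enat j" "enat (Suc j)"])
    \<comment> \<open>Factoring \<open>r ^ j - r ^ Suc j\<close> exposes exactly the left sides of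
      \<open>balance\<close>.\<close>
    also have "\<dots> = pmf \<pi> (1,0) * (1 - r) * r ^ j + pmf \<pi> (0,1) * (1 - s) * s ^ j"
      by (simp add: tail algebra_simps)
    finally show ?thesis by (simp only: balance)
  qed
  have prob_pos: "\<P>(\<omega> in M. C\<^sub>E t \<omega> = enat i) =
      p * (1 - q) ^ (i - 1) * (1 - a 1) ^ i * pmf \<pi> (0,0)
      + q * (1 - p) ^ (i - 1) * (1 - a 0) ^ i * pmf \<pi> (1,1)" if "i \<ge> 1" for i t
    using that by (cases i) (simp_all add: prob_Suc r_def s_def power_mult_distrib)

  \<comment> \<open>Transition probabilities\<close>
  have cond: "\<P>(\<omega> in M. C\<^sub>E (t + 1) \<omega> = enat (i + 1) \<bar> C\<^sub>E t \<omega> = enat i) =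
      \<P>(\<omega> in M. C\<^sub>E (t + 1) \<omega> = enat (i + 1)) / \<P>(\<omega> in M. C\<^sub>E t \<omega> = enat i)" for i
  proof -
    have "{\<omega> \<in> space M. C\<^sub>E (t + 1) \<omega> = enat (i + 1) \<and> C\<^sub>E t \<omega> = enat i} =
        {\<omega> \<in> space M. C\<^sub>E (t + 1) \<omega> = enat (i + 1)}"
      using consecutive_error_shift[of X Xhat t _ i] by (auto simp: C\<^sub>E)
    then show ?thesis by (simp add: cond_prob_def)
  qed
  have cond_0: "\<P>(\<omega> in M. C\<^sub>E (t + 1) \<omega> = 1 \<bar> C\<^sub>E t \<omega> = 0) =
      (p * (1 - a 1) * pmf \<pi> (0,0) + q * (1 - a 0) * pmf \<pi> (1,1)) / (pmf \<pi> (0,0) + pmf \<pi> (1,1))"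
    using cond[of 0] prob_pos[of 1] by (simp add: prob_0 one_enat_def flip: zero_enat_def)
  have cond_pos: "\<P>(\<omega> in M. C\<^sub>E (t + 1) \<omega> = enat (i + 1) \<bar> C\<^sub>E t \<omega> = enat i) =
         (p * (1 - q) ^ i * (1 - a 1) ^ (i + 1) * pmf \<pi> (0,0)
          + q * (1 - p) ^ i * (1 - a 0) ^ (i + 1) * pmf \<pi> (1,1))
         / (p * (1 - q) ^ (i - 1) * (1 - a 1) ^ i * pmf \<pi> (0,0)
            + q * (1 - p) ^ (i - 1) * (1 - a 0) ^ i * pmf \<pi> (1,1))" if "i \<ge> 1" for i
    using cond[of i] prob_pos[OF that] prob_pos[of "i + 1"] by simp

  \<comment> \<open>Average and violation probability\<close>
  have mean: "((\<lambda>x::nat. real x * \<P>(\<omega> in M. C\<^sub>E t \<omega> = enat x)) has_sum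
        (p * (1 - a 1) * pmf \<pi> (0,0) / (q + (1 - q) * a 1)\<^sup>2
         + q * (1 - a 0) * pmf \<pi> (1,1) / (p + (1 - p) * a 0)\<^sup>2)) {1..}"
  proof -
    let ?c = "p * (1 - a 1) * pmf \<pi> (0,0)" and ?d = "q * (1 - a 0) * pmf \<pi> (1,1)"
    \<comment> \<open>Differentiated geometric series, indexed by \<open>x = Suc j\<close>.
      Nonnegative terms then allow the passage to an unordered sum, reindexed by \<open>Suc\<close>
      onto \<open>{1..}\<close>.\<close>
    have "(\<lambda>j. ?c * (real (Suc j) * r ^ j) + ?d * (real (Suc j) * s ^ j)) sums
        (?c * (1 / (1 - r)\<^sup>2) + ?d * (1 / (1 - s)\<^sup>2))"
      using rs by (intro sums_add sums_mult geometric_deriv_sums) auto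
    then have "(\<lambda>j. real (Suc j) * \<P>(\<omega> in M. C\<^sub>E t \<omega> = enat (Suc j))) sums
        (?c / (q + (1 - q) * a 1)\<^sup>2 + ?d / (p + (1 - p) * a 0)\<^sup>2)"
      unfolding prob_Suc escape by (simp add: distrib_left mult_ac del: of_nat_Suc)
    then have "((\<lambda>j. real (Suc j) * \<P>(\<omega> in M. C\<^sub>E t \<omega> = enat (Suc j))) has_sum
        (?c / (q + (1 - q) * a 1)\<^sup>2 + ?d / (p + (1 - p) * a 0)\<^sup>2)) UNIV"
      by (rule sums_nonneg_imp_has_sum) simp
    moreover have "bij_betw Suc UNIV {1::nat..}"
      by (rule bij_betw_byWitness[where f' = "\<lambda>x. x - 1"]) auto
    ultimately show ?thesis
      by (subst has_sum_reindex_bij_betw[symmetric])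
  qed

  have violation: "\<P>(\<omega> in M. C\<^sub>E t \<omega> > enat n) =
       p * q * a 0 * ((1 - q) * (1 - a 1)) ^ (n + 1) / ((1 - q) * (p + q) * \<Phi>)
       + p * q * a 1 * ((1 - p) * (1 - a 0)) ^ (n + 1) / ((1 - p) * (p + q) * \<Phi>)" for n
    \<comment> \<open>The claimed exponent \<open>n + 1\<close> over \<open>1 - q\<close> is
      \<open>(1 - a 1) * r ^ n\<close>, whose first factor comes from
      \<open>pmf \<pi> (1,0)\<close>; likewise for \<open>s\<close>.\<close>
    using p q by (simp add: tail pi r_def s_def)

  show ?thesis
    using prob_0 prob_pos cond_0 cond_pos mean violation by blast
qed

end
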